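(* Let $u\in\mathbb{C}$ and let $v\in\mathbb{R}$ with $v\neq 0$, such that $-u\notin\mathbb{N}+\frac{2iv}{\pi}\mathbb{N}$. Then the power series $$\sum_{n\ge 0}\Gamma\Bigl(u+\frac{2ivn}{\pi}\Bigr)z^n$$ has the circle $|z|=e^{|v|}$ as a natural boundary.
   Context: $\Gamma$ is the Euler Gamma function (meromorphic on $\mathbb{C}$, with poles exactly at the points of $-\mathbb{N}$), $\mathbb{N}=\{0,1,2,\dots\}$, and $\mathbb{N}+\frac{2iv}{\pi}\mathbb{N}=\{m+\frac{2iv}{\pi}n : m,n\in\mathbb{N}\}$. A power series has the circle $|z|=R$ as a natural boundary if its radius of convergence is $R$ and its sum $f$, analytic in the disc $\Omega=\{|z|<R\}$, cannot be continued analytically across any point of the circle: for every $z_0$ with $|z_0|=R$ there is no open disc $D$ centred at $z_0$ and no holomorphic function $g$ on $D$ with $g=f$ on $D\cap\Omega$. *)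

theory Defs
  imports "HOL-Complex_Analysis.Complex_Analysis"
begin

definition has_natural_boundary :: "(nat \<Rightarrow> complex) \<Rightarrow> real \<Rightarrow> bool" where
  "has_natural_boundary a R \<longleftrightarrow>
     conv_radius a = ereal R \<and>
     (\<forall>z0. norm z0 = R \<longrightarrow>
        \<not> (\<exists>r g. r > 0 \<and> g holomorphic_on ball z0 r \<and>
               (\<forall>z \<in> ball z0 r \<inter> ball 0 R. g z = (\<Sum>n. a n * z ^ n))))"

end

theory Submission
  imports Defs
begin

text \<open>Normalised to radius \<open>1\<close>, the coefficients have quotients of the form
\<open>exp (\<i> * \<omega> * ln (\<bar>\<omega>\<bar> * n)) * (1 + O(1 / n))\<close> with \<open>\<omega> = 2 * v / pi\<close>, by the asymptotics of a Gamma quotient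
along the imaginary axis (\<open>Gamma_vertical_step_asymptotic\<close>). The phase turns without end, but ever
more slowly. Hence, given a boundary point, there are indices \<open>m\<close> from which on, for longer
and longer stretches, the coefficients look like those of a geometric series with its pole at
that point (\<open>exists_indices_log_phase\<close>).

Such a point is singular by an argument in the manner of M. Riesz (\<open>singular_at_1_of_ratio_limit\<close>).
Let the point be \<open>1\<close>, and suppose that the sum continues to \<open>g\<close> near \<open>1\<close>. Subtract from \<open>g\<close> the terms of index
below \<open>m\<close> and divide by the term of index \<open>m\<close>. Inside the unit disc the result is the power series with
coefficients \<open>b (m + l) / b m\<close>; outside it is controlled by the finite sum of \<open>b (m - l) / b m\<close>.
As the quotients have modulus \<open>1 + O(1 / n)\<close>, both are bounded by a fixed power of the reciprocal
distance to the unit circle, uniformly in \<open>m\<close>. A polynomial factor that is small where a little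
circle about \<open>1\<close> meets the unit circle absorbs this power, and the maximum principle bounds the
normalised tails near \<open>1\<close>, uniformly in \<open>m\<close>. But along the chosen indices they converge to
\<open>1 / (1 - z)\<close>, which is unbounded near \<open>1\<close>.

The hypothesis on \<open>u\<close> says that no argument of Gamma is a pole. The totalised Gamma function vanishes only at poles,
so all coefficients are nonzero and the quotients make sense from the first index on.\<close>


section \<open>Coefficient quotients and singular points\<close>

lemma sums_binomial_shift:
  fixes x :: real
  assumes "0 \<le> x" "x < 1"
  shows "(\<lambda>l. real ((l + K) choose K) * x ^ l) sums (1 / (1 - x) ^ Suc K)"
proof -
  have "(\<lambda>l. ((- real (Suc K)) gchoose l) * (- x) ^ l) sums (1 + (- x)) powr (- real (Suc K))"
    using assms by (intro gen_binomial_real) auto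
  moreover have "((- real (Suc K)) gchoose l) * (- x) ^ l = real ((l + K) choose K) * x ^ l" for l
  proof -
    have "((- real (Suc K)) gchoose l) = (- 1) ^ l * (real (K + l) gchoose l)"
      by (subst gbinomial_minus) simp
    also have "real (K + l) gchoose l = real ((l + K) choose K)"
      using binomial_symmetric[of K "l + K"] unfolding binomial_gbinomial [symmetric]
      by (simp add: add.commute)
    finally show ?thesis
      by (simp add: power_mult_distrib [symmetric] mult.commute mult.left_commute)
  qed
  moreover have "(1 + (- x)) powr (- real (Suc K)) = 1 / (1 - x) ^ Suc K"
    using assms by (simp add: powr_minus powr_realpow field_simps del: of_nat_Suc)
  ultimately show ?thesis by simp
qed

lemma ratio_factor_binomial:
  "(1 + real K / (real l + 1)) * real ((l + K) choose K) = real ((Suc l + K) choose K)"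
proof -
  have "Suc l * (Suc l + K choose K) = (Suc l + K) * (l + K choose K)"
    using Suc_times_binomial_add[of l K] Suc_times_binomial_eq[of "l + K" l]
      binomial_symmetric[of K "l + K"] binomial_symmetric[of K "Suc l + K"]
    by (simp add: add.commute mult.commute)
  then have "(real l + 1) * real (Suc l + K choose K) = (real l + 1 + K) * real (l + K choose K)"
    by (metis (no_types, lifting) of_nat_Suc of_nat_add of_nat_mult add.commute)
  then show ?thesis by (simp add: field_simps del: binomial_Suc_Suc)
qed

text \<open>The product of the factors \<open>1 + K / (k + 1)\<close> over \<open>l\<close> consecutive indices \<open>k\<close> is largest
when the indices start at \<open>0\<close>, and there it telescopes to a binomial coefficient. The bound is
thus independent of \<open>m\<close>, and its generating function is known in closed form.\<close>

lemma norm_ratio_le_binomial: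
  fixes b :: "nat \<Rightarrow> complex"
  assumes up: "\<And>n. norm (b (Suc n)) \<le> (1 + real K / (real n + 1)) * norm (b n)"
    and lo: "\<And>n. norm (b n) \<le> (1 + real K / (real n + 1)) * norm (b (Suc n))"
  shows "norm (b (m + l)) \<le> real ((l + K) choose K) * norm (b m)"
    and "norm (b m) \<le> real ((l + K) choose K) * norm (b (m + l))"
proof -
  have mono: "1 + real K / (real (m + l) + 1) \<le> 1 + real K / (real l + 1)" for l
    by (intro add_mono divide_left_mono) auto
  show "norm (b (m + l)) \<le> real ((l + K) choose K) * norm (b m)"
  proof (induction l)
    case (Suc l)
    have "norm (b (m + Suc l)) \<le> (1 + real K / (real (m + l) + 1)) * norm (b (m + l))"
      using up[of "m + l"] by simp
    also have "\<dots> \<le> (1 + real K / (real l + 1)) * (real ((l + K) choose K) * norm (b m))"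
      using mono[of l] Suc by (intro mult_mono) auto
    finally show ?case by (simp only: mult.assoc[symmetric] ratio_factor_binomial)
  qed simp
  show "norm (b m) \<le> real ((l + K) choose K) * norm (b (m + l))"
  proof (induction l)
    case (Suc l)
    have "norm (b m) \<le> real ((l + K) choose K) * norm (b (m + l))" by (rule Suc)
    also have "\<dots> \<le> real ((l + K) choose K) *
        ((1 + real K / (real (m + l) + 1)) * norm (b (m + Suc l)))"
      using lo[of "m + l"] by (intro mult_left_mono) auto
    also have "\<dots> \<le> real ((l + K) choose K) *
        ((1 + real K / (real l + 1)) * norm (b (m + Suc l)))"
      using mono[of l] by (intro mult_left_mono mult_right_mono) auto
    also have "\<dots> = (1 + real K / (real l + 1)) * real ((l + K) choose K) * norm (b (m + Suc l))"
      by (simp add: mult_ac)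
    finally show ?case by (simp only: ratio_factor_binomial)
  qed simp
qed

text \<open>On a circle of radius \<open>\<rho>\<close> centred at \<open>1\<close>, conjugation is the rational map
\<open>cnj z = 1 + \<rho>\<^sup>2 / (z - 1)\<close>, so \<open>z * cnj z - 1\<close> agrees there with a holomorphic function. This
provides a polynomial which on the circle has exactly the size of the distance to the unit circle,
up to a bounded factor, and which does not vanish at \<open>1\<close>.\<close>

lemma norm_quadratic_on_circle:
  fixes z :: complex
  assumes "norm (z - 1) = \<rho>"
  shows "norm (z\<^sup>2 - (2 - of_real (\<rho>\<^sup>2)) * z + 1) = \<rho> * \<bar>(norm z)\<^sup>2 - 1\<bar>"
proof -
  have 1: "of_real (\<rho>\<^sup>2) = (z - 1) * (cnj z - 1)"
    using complex_norm_square[of "z - 1"] assms by simp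
  have "z\<^sup>2 - (2 - of_real (\<rho>\<^sup>2)) * z + 1 = (z - 1) * of_real ((norm z)\<^sup>2 - 1)"
    unfolding 1 of_real_diff complex_norm_square by (simp add: algebra_simps power2_eq_square)
  then show ?thesis by (simp add: norm_mult assms del: of_real_diff of_real_power)
qed

text \<open>For the sum \<open>g\<close> of a power series this is the series with coefficients \<open>b (m + l) / b m\<close>; the
quotient still makes sense wherever \<open>g\<close> has been continued.\<close>

definition normalized_tail :: "(nat \<Rightarrow> complex) \<Rightarrow> (complex \<Rightarrow> complex) \<Rightarrow> nat \<Rightarrow> complex \<Rightarrow> complex"
  where "normalized_tail b g m z = (g z - (\<Sum>n<m. b n * z ^ n)) / (b m * z ^ m)"

context
  fixes b :: "nat \<Rightarrow> complex" and K :: nat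
  assumes nz: "\<And>n. b n \<noteq> 0"
    and up: "\<And>n. norm (b (Suc n)) \<le> (1 + real K / (real n + 1)) * norm (b n)"
    and lo: "\<And>n. norm (b n) \<le> (1 + real K / (real n + 1)) * norm (b (Suc n))"
begin

lemma norm_tail_coeff_le:
  "norm (b (m + l) / b m * z ^ l) \<le> real ((l + K) choose K) * norm z ^ l"
proof -
  have "norm (b (m + l) / b m) \<le> real ((l + K) choose K)"
    using norm_ratio_le_binomial(1)[of b K m l, OF up lo] nz[of m]
    by (simp add: norm_divide field_simps)
  then show ?thesis unfolding norm_mult norm_power by (intro mult_right_mono) auto
qed

lemma summable_tail:
  assumes "norm z < 1"
  shows "summable (\<lambda>l. norm (b (m + l) / b m * z ^ l))"
proof (rule summable_comparison_test')
  show "summable (\<lambda>l. real ((l + K) choose K) * norm z ^ l)"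
    using sums_binomial_shift[of "norm z" K] assms by (simp add: sums_iff)
  show "norm (norm (b (m + l) / b m * z ^ l)) \<le> real ((l + K) choose K) * norm z ^ l" for l
    using norm_tail_coeff_le by simp
qed

lemma normalized_tail_inside:
  assumes "norm z < 1" "z \<noteq> 0" and g: "g z = (\<Sum>n. b n * z ^ n)"
  shows "normalized_tail b g m z = (\<Sum>l. b (m + l) / b m * z ^ l)"
proof -
  have "summable (\<lambda>l. b (0 + l) / b 0 * z ^ l)"
    using summable_norm_cancel[OF summable_tail[OF assms(1), of 0]] .
  from summable_mult[OF this, of "b 0"] have sm: "summable (\<lambda>n. b n * z ^ n)"
    using nz[of 0] by (simp add: mult.assoc[symmetric])
  have "g z - (\<Sum>n<m. b n * z ^ n) = (\<Sum>l. b (l + m) * z ^ (l + m))"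
    unfolding g using suminf_minus_initial_segment[OF sm, of m] by simp
  also have "\<dots> = (\<Sum>l. (b m * z ^ m) * (b (m + l) / b m * z ^ l))"
    using nz[of m] by (intro suminf_cong) (simp add: power_add add.commute)
  also have "\<dots> = (b m * z ^ m) * (\<Sum>l. b (m + l) / b m * z ^ l)"
    using summable_norm_cancel[OF summable_tail[OF assms(1), of m]] by (intro suminf_mult)
  finally have eq: "g z - (\<Sum>n<m. b n * z ^ n) = (b m * z ^ m) * (\<Sum>l. b (m + l) / b m * z ^ l)" .
  have "b m * z ^ m \<noteq> 0" using nz[of m] assms(2) by simp
  then show ?thesis unfolding normalized_tail_def eq by (rule nonzero_mult_div_cancel_left)
qed

lemma norm_normalized_tail_inside:
  assumes "norm z < 1" "z \<noteq> 0" and g: "g z = (\<Sum>n. b n * z ^ n)"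
  shows "norm (normalized_tail b g m z) \<le> 1 / (1 - norm z) ^ Suc K"
proof -
  have "norm (normalized_tail b g m z) \<le> (\<Sum>l. norm (b (m + l) / b m * z ^ l))"
    unfolding normalized_tail_inside[of z g m, OF assms] by (rule summable_norm[OF summable_tail[OF assms(1)]])
  also have "\<dots> \<le> (\<Sum>l. real ((l + K) choose K) * norm z ^ l)"
    using sums_binomial_shift[of "norm z" K] assms(1)
    by (intro suminf_le[OF norm_tail_coeff_le summable_tail[OF assms(1)]]) (simp add: sums_iff)
  also have "\<dots> = 1 / (1 - norm z) ^ Suc K"
    using sums_binomial_shift[of "norm z" K] assms(1) by (simp add: sums_iff)
  finally show ?thesis .
qed

text \<open>Outside the unit disc the partial sum, divided by \<open>b m * z ^ m\<close> and read backwards, is a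
polynomial in \<open>1 / z\<close> with coefficients \<open>b (m - l) / b m\<close>. The term \<open>g z\<close> has the
same kind of bound, since comparing \<open>b 0\<close> with \<open>b m\<close> shows that \<open>b m\<close> decays at most polynomially.\<close>

lemma norm_normalized_tail_outside:
  assumes "norm z > 1" and g: "norm (g z) \<le> M"
  shows "norm (normalized_tail b g m z) \<le> (1 + M / norm (b 0)) / (1 - 1 / norm z) ^ Suc K"
proof -
  define x where "x = 1 / norm z"
  have x: "0 < x" "x < 1" using assms(1) by (auto simp: x_def divide_simps)
  define S where "S = 1 / (1 - x) ^ Suc K"
  have S: "(\<lambda>l. real ((l + K) choose K) * x ^ l) sums S"
    using sums_binomial_shift[of x K] x by (simp add: S_def)
  have M: "M \<ge> 0" using g norm_ge_zero[of "g z"] by linarith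
  have nzz: "norm z > 0" using assms(1) by linarith
  have le: "norm (b n * z ^ n / (b m * z ^ m)) \<le> real ((m - n + K) choose K) * x ^ (m - n)"
    if "n \<le> m" for n
  proof -
    have "norm (b n) / norm (b m) \<le> real ((m - n + K) choose K)"
      using norm_ratio_le_binomial(2)[of b K n "m - n", OF up lo] nz[of m] that
      by (simp add: field_simps)
    moreover have "norm z ^ n / norm z ^ m = x ^ (m - n)"
      using that nzz by (simp add: x_def power_diff field_simps)
    ultimately show ?thesis
      unfolding norm_divide norm_mult norm_power times_divide_times_eq[symmetric]
      using x by (metis mult_right_mono zero_le_power less_imp_le)
  qed
  have part: "(\<Sum>l\<in>I. real ((l + K) choose K) * x ^ l) \<le> S" if "finite I" for I
    using sum_le_suminf[OF sums_summable[OF S] that] sums_unique[OF S] x by simp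
  have "norm ((\<Sum>n<m. b n * z ^ n) / (b m * z ^ m)) \<le> (\<Sum>n<m. norm (b n * z ^ n / (b m * z ^ m)))"
    unfolding sum_divide_distrib by (rule norm_sum)
  also have "\<dots> \<le> (\<Sum>n<m. real ((m - n + K) choose K) * x ^ (m - n))"
    by (intro sum_mono le) auto
  also have "\<dots> = (\<Sum>l\<in>{1..m}. real ((l + K) choose K) * x ^ l)"
    by (rule sum.reindex_bij_witness[of _ "\<lambda>l. m - l" "\<lambda>n. m - n"]) auto
  also have "\<dots> \<le> S" by (rule part) auto
  finally have 1: "norm ((\<Sum>n<m. b n * z ^ n) / (b m * z ^ m)) \<le> S" .
  have "norm (g z / (b m * z ^ m)) = norm (g z) / norm (b 0) * norm (b 0 * z ^ 0 / (b m * z ^ m))"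
    using nz[of 0] by (simp add: norm_mult norm_divide)
  also have "\<dots> \<le> M / norm (b 0) * S"
    using g le[of 0] part[of "{m}"] M by (intro mult_mono divide_right_mono) auto
  finally have 2: "norm (g z / (b m * z ^ m)) \<le> M / norm (b 0) * S" .
  have "norm (normalized_tail b g m z) \<le> M / norm (b 0) * S + S"
    unfolding normalized_tail_def diff_divide_distrib using norm_triangle_ineq4 1 2
    by (meson add_mono order_trans)
  also have "\<dots> = (1 + M / norm (b 0)) * S" by (simp add: algebra_simps)
  finally show ?thesis by (simp add: S_def x_def)
qed

text \<open>Both one-sided estimates blow up at the unit circle at most like the power \<open>K + 1\<close> of the
reciprocal distance. Multiplying by that power of the quadratic polynomial removes the blow-up on a
small circle about \<open>1\<close>, and the maximum principle carries a bound uniform in \<open>m\<close> to the inside.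
Along the given indices the normalised tails tend to the geometric series, whose pole at \<open>1\<close>
violates the bound.\<close>

lemma singular_at_1_of_ratio_limit:
  assumes lim: "\<And>l. (\<lambda>j. b (m j + l) / b (m j)) \<longlonglongrightarrow> 1"
    and r: "r > 0" and hol: "g holomorphic_on ball 1 r"
    and g: "\<And>z. z \<in> ball 1 r \<inter> ball 0 1 \<Longrightarrow> g z = (\<Sum>n. b n * z ^ n)"
  shows False
proof -
  define \<rho> where "\<rho> = min (r / 2) (1 / 2)"
  have \<rho>: "0 < \<rho>" "\<rho> \<le> 1 / 2" "\<rho> < r" using r by (auto simp: \<rho>_def)
  have sub: "cball 1 \<rho> \<subseteq> ball 1 r" using \<rho> by auto
  have ne0: "z \<noteq> 0" if "z \<in> cball 1 \<rho>" for z :: complex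
    using that \<rho> by (auto simp: dist_norm)
  define Q :: "complex \<Rightarrow> complex" where "Q = (\<lambda>z. z\<^sup>2 - (2 - of_real (\<rho>\<^sup>2)) * z + 1)"
  have "compact (g ` cball 1 \<rho>)"
    using holomorphic_on_imp_continuous_on[OF holomorphic_on_subset[OF hol sub]]
    by (intro compact_continuous_image) auto
  then obtain M where M: "\<And>z. z \<in> cball 1 \<rho> \<Longrightarrow> norm (g z) \<le> M"
    using compact_imp_bounded bounded_iff by (metis imageI)
  define C where "C = (1 + M / norm (b 0)) * (4 * \<rho>) ^ Suc K"
  have "norm (g 1) \<le> M" using \<rho> by (intro M) auto
  then have M0: "M \<ge> 0" using norm_ge_zero[of "g 1"] by linarith
  have A: "norm (Q z ^ Suc K * normalized_tail b g m z) \<le> C" if z: "norm (z - 1) = \<rho>" for z m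
  proof -
    have zin: "z \<in> cball 1 \<rho>" using z by (simp add: dist_norm norm_minus_commute)
    have nz2: "norm z \<le> 3 / 2" using z \<rho> norm_triangle_ineq[of "z - 1" 1] by simp
    have Q: "norm (Q z) = \<rho> * (\<bar>norm z - 1\<bar> * (norm z + 1))"
    proof -
      have "(norm z)\<^sup>2 - 1 = (norm z - 1) * (norm z + 1)"
        by (simp add: algebra_simps power2_eq_square)
      then show ?thesis
        unfolding Q_def norm_quadratic_on_circle[OF z] by (simp add: abs_mult)
    qed
    \<comment> \<open>Here \<open>X\<close> stands for the factor \<open>1 / (1 - norm z)\<close> or \<open>1 / (1 - 1 / norm z)\<close> of either estimate.\<close>
    have P: "norm (Q z) * X \<le> 4 * \<rho>" if "X \<ge> 0" "\<bar>norm z - 1\<bar> * X \<le> max 1 (norm z)" for X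
    proof -
      have "max 1 (norm z) * (norm z + 1) \<le> 3 / 2 * (5 / 2)" using nz2 by (intro mult_mono) auto
      moreover have "(norm z + 1) * (\<bar>norm z - 1\<bar> * X) \<le> (norm z + 1) * max 1 (norm z)"
        using that by (intro mult_left_mono) auto
      ultimately have "(norm z + 1) * (\<bar>norm z - 1\<bar> * X) \<le> 4" by (simp add: mult.commute)
      then have "\<rho> * ((norm z + 1) * (\<bar>norm z - 1\<bar> * X)) \<le> \<rho> * 4"
        using \<rho> by (intro mult_left_mono) auto
      then show ?thesis unfolding Q by (simp add: mult_ac)
    qed
    have one: "(1::real) \<le> 1 + M / norm (b 0)" using M0 by simp
    \<comment> \<open>Where the circle meets the unit circle, nothing is known about the tail, but there \<open>Q\<close> vanishes.\<close>
    consider "norm z < 1" | "norm z = 1" | "norm z > 1" by linarith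
    then show ?thesis
    proof cases
      case 1
      have "norm (Q z ^ Suc K * normalized_tail b g m z) \<le> norm (Q z) ^ Suc K * (1 / (1 - norm z) ^ Suc K)"
        unfolding norm_mult norm_power using 1 zin g[of z] sub ne0[OF zin]
        by (intro mult_left_mono norm_normalized_tail_inside) auto
      also have "\<dots> = (norm (Q z) * (1 / (1 - norm z))) ^ Suc K"
        by (simp add: power_divide power_mult_distrib)
      also have "\<dots> \<le> (4 * \<rho>) ^ Suc K"
        using 1 by (intro power_mono P) auto
      also have "\<dots> \<le> C" unfolding C_def using mult_right_mono[OF one, of "(4 * \<rho>) ^ Suc K"] \<rho> by simp
      finally show ?thesis .
    next
      case 2
      then have "Q z = 0" using Q by simp
      then show ?thesis using M0 \<rho> by (simp add: C_def)
    next
      case 3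
      have "norm (Q z ^ Suc K * normalized_tail b g m z) \<le>
          norm (Q z) ^ Suc K * ((1 + M / norm (b 0)) / (1 - 1 / norm z) ^ Suc K)"
        unfolding norm_mult norm_power using 3 M[OF zin]
        by (intro mult_left_mono norm_normalized_tail_outside) auto
      also have "\<dots> = (1 + M / norm (b 0)) * (norm (Q z) * (1 / (1 - 1 / norm z))) ^ Suc K"
        by (simp add: power_divide power_mult_distrib)
      also have "\<dots> \<le> C"
        unfolding C_def
      proof (intro mult_left_mono power_mono P)
        have "z \<noteq> 0" using 3 by (intro notI) simp
        then have "1 - 1 / norm z = (norm z - 1) / norm z" by (simp add: diff_divide_distrib)
        then have eq: "1 / (1 - 1 / norm z) = norm z / (norm z - 1)" using 3 by simp
        show "0 \<le> 1 / (1 - 1 / norm z)" unfolding eq using 3 by simp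
        then show "0 \<le> norm (Q z) * (1 / (1 - 1 / norm z))" by (intro mult_nonneg_nonneg) auto
        show "\<bar>norm z - 1\<bar> * (1 / (1 - 1 / norm z)) \<le> max 1 (norm z)" unfolding eq using 3 by simp
      qed (use M0 in auto)
      finally show ?thesis .
    qed
  qed
  have B: "norm (Q z ^ Suc K * normalized_tail b g m z) \<le> C" if z: "z \<in> cball 1 \<rho>" for z m
  proof (rule maximum_modulus_frontier[of "\<lambda>z. Q z ^ Suc K * normalized_tail b g m z" "cball 1 \<rho>"])
    have "(\<lambda>z. Q z ^ Suc K * normalized_tail b g m z) holomorphic_on cball 1 \<rho>"
      unfolding normalized_tail_def Q_def using holomorphic_on_subset[OF hol sub] nz ne0
      by (intro holomorphic_intros) auto
    then show "(\<lambda>z. Q z ^ Suc K * normalized_tail b g m z) holomorphic_on interior (cball 1 \<rho>)"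
      and "continuous_on (closure (cball 1 \<rho>)) (\<lambda>z. Q z ^ Suc K * normalized_tail b g m z)"
      by (auto intro: holomorphic_on_subset holomorphic_on_imp_continuous_on)
    show "norm (Q z ^ Suc K * normalized_tail b g m z) \<le> C" if "z \<in> frontier (cball 1 \<rho>)" for z
      using that \<rho> by (intro A) (auto simp: dist_norm norm_minus_commute)
  qed (use z in auto)
  have D: "norm (Q (of_real s)) ^ Suc K \<le> C * (1 - s)" if s: "1 - \<rho> < s" "s < 1" for s
  proof -
    let ?z = "of_real s :: complex"
    have s0: "s > 0" using s \<rho> by simp
    have "1 - ?z = of_real (1 - s)" by simp
    then have nd: "norm (1 - ?z) = 1 - s" using s by (simp only: norm_of_real abs_of_pos)
    then have zin: "?z \<in> cball 1 \<rho>" using s by (simp add: dist_norm)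
    have ns: "norm ?z = s" using s0 by simp
    have gs: "g ?z = (\<Sum>n. b n * ?z ^ n)" using zin sub s s0 by (intro g) auto
    have "(\<lambda>j. \<Sum>l. b (m j + l) / b (m j) * ?z ^ l) \<longlonglongrightarrow> (\<Sum>l. 1 * ?z ^ l)"
    proof (rule conjunct2[OF conjunct2[OF tannerys_theorem]])
      show "(\<lambda>j. b (m j + l) / b (m j) * ?z ^ l) \<longlonglongrightarrow> 1 * ?z ^ l" for l
        by (intro tendsto_intros lim)
      show "\<forall>\<^sub>F (l, j) in at_top \<times>\<^sub>F sequentially.
          norm (b (m j + l) / b (m j) * ?z ^ l) \<le> real ((l + K) choose K) * s ^ l"
        using norm_tail_coeff_le[where z = ?z] unfolding ns by (intro always_eventually) auto
      show "summable (\<lambda>l. real ((l + K) choose K) * s ^ l)"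
        using sums_binomial_shift[of s K] s s0 by (simp add: sums_iff)
    qed simp
    moreover have "normalized_tail b g k ?z = (\<Sum>l. b (k + l) / b k * ?z ^ l)" for k
      using s s0 ns by (intro normalized_tail_inside gs) auto
    moreover have "(\<Sum>l. 1 * ?z ^ l) = 1 / (1 - ?z)"
      using suminf_geometric[of ?z] s ns by simp
    ultimately have "(\<lambda>j. normalized_tail b g (m j) ?z) \<longlonglongrightarrow> 1 / (1 - ?z)"
      by (simp only:)
    then have "(\<lambda>j. norm (Q ?z ^ Suc K * normalized_tail b g (m j) ?z))
        \<longlonglongrightarrow> norm (Q ?z ^ Suc K * (1 / (1 - ?z)))"
      by (intro tendsto_intros)
    then have "norm (Q ?z ^ Suc K * (1 / (1 - ?z))) \<le> C"
      by (rule Lim_bounded) (use B[OF zin] in auto)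
    then show ?thesis using s by (simp add: nd norm_mult norm_divide norm_power pos_divide_le_eq)
  qed
  have "((\<lambda>s. norm (Q (of_real s)) ^ Suc K) \<longlongrightarrow> norm (Q (of_real 1)) ^ Suc K) (at_left 1)"
    unfolding Q_def by (intro tendsto_intros)
  moreover have "((\<lambda>s. C * (1 - s)) \<longlongrightarrow> C * (1 - 1)) (at_left 1)" by (intro tendsto_intros)
  moreover have "eventually (\<lambda>s. norm (Q (of_real s)) ^ Suc K \<le> C * (1 - s)) (at_left 1)"
  proof (rule eventually_mono[OF eventually_at_left_real[of "1 - \<rho>" 1]])
    show "norm (Q (of_real s)) ^ Suc K \<le> C * (1 - s)" if "s \<in> {1 - \<rho><..<1}" for s
      using that D[of s] by (simp only: greaterThanLessThan_iff)
  qed (use \<rho> in simp)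
  ultimately have "norm (Q (of_real 1)) ^ Suc K \<le> C * (1 - 1)"
    by (intro tendsto_le[of "at_left (1::real)"]) auto
  moreover have "Q (of_real 1) = of_real (\<rho>\<^sup>2)" by (simp add: Q_def)
  then have "norm (Q (of_real 1)) ^ Suc K > 0" using \<rho> by (simp del: power_Suc)
  ultimately show False by (metis diff_self mult_zero_right not_less)
qed

end

section \<open>Gamma quotients along the imaginary axis\<close>

lemma sum_inverse_square_shift_le:
  fixes t :: real
  assumes "t \<ge> 1"
  shows "(\<Sum>k<N. 1 / (t + real k)\<^sup>2) \<le> 2 / t"
proof -
  have "1 / (t + real k)\<^sup>2 \<le> 2 / (t + real k) - 2 / (t + real (Suc k))" for k
  proof -
    define x where "x = t + real k"
    have "x \<ge> 1" using assms by (simp add: x_def)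
    then have "1 / x\<^sup>2 \<le> 2 / x - 2 / (x + 1)"
      by (simp add: divide_simps power2_eq_square)
    then show ?thesis by (simp add: x_def add_ac)
  qed
  then have "(\<Sum>k<N. 1 / (t + real k)\<^sup>2) \<le> (\<Sum>k<N. 2 / (t + real k) - 2 / (t + real (Suc k)))"
    by (intro sum_mono)
  also have "\<dots> = 2 / t - 2 / (t + real N)"
    using sum_lessThan_telescope'[of "\<lambda>k. 2 / (t + real k)" N] by simp
  also have "\<dots> \<le> 2 / t" using assms by simp
  finally show ?thesis .
qed

lemma norm_add_of_nat_square_ge:
  fixes y :: complex
  assumes "Re y \<ge> 0"
  shows "(norm y + real k)\<^sup>2 \<le> 2 * (norm (y + of_nat k))\<^sup>2"
proof -
  have "(norm y)\<^sup>2 + (real k)\<^sup>2 \<le> (norm (y + of_nat k))\<^sup>2"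
    using assms by (simp add: cmod_power2 power2_sum)
  moreover have "(norm y + real k)\<^sup>2 \<le> 2 * ((norm y)\<^sup>2 + (real k)\<^sup>2)"
    using sum_squares_bound[of "norm y" "real k"] by (simp add: power2_sum)
  ultimately show ?thesis by (meson mult_left_mono order_trans zero_le_numeral)
qed

text \<open>The first-order terms \<open>a * w\<close> cancel; this cancellation makes the product for a Gamma quotient
converge with a quadratically small remainder.\<close>

lemma norm_log_factor_le:
  fixes a w :: complex
  assumes "norm w \<le> 1 / 2" "norm (a * w) \<le> 1 / 2"
  shows "norm (a * Ln (1 + w) - Ln (1 + a * w)) \<le> 2 * (norm a + (norm a)\<^sup>2) * (norm w)\<^sup>2"
proof -
  have ln: "norm (Ln (1 + z) - z) \<le> 2 * (norm z)\<^sup>2" if "norm z \<le> 1 / 2" for z :: complex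
  proof -
    have "norm (Ln (1 + z) - z) \<le> (norm z)\<^sup>2 / (1 - norm z)"
      using that by (intro Ln_approx_linear) auto
    also have "\<dots> \<le> (norm z)\<^sup>2 / (1 / 2)" using that by (intro divide_left_mono) auto
    finally show ?thesis by simp
  qed
  have "a * Ln (1 + w) - Ln (1 + a * w) = a * (Ln (1 + w) - w) - (Ln (1 + a * w) - a * w)"
    by (simp add: algebra_simps)
  also have "norm \<dots> \<le> norm a * (2 * (norm w)\<^sup>2) + 2 * (norm (a * w))\<^sup>2"
    using mult_left_mono[OF ln[OF assms(1)] norm_ge_zero[of a]] ln[OF assms(2)]
    by (intro order_trans[OF norm_triangle_ineq4[of "a * (Ln (1 + w) - w)" "Ln (1 + a * w) - a * w"]] add_mono)
      (simp_all only: norm_mult)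
  also have "\<dots> = 2 * (norm a + (norm a)\<^sup>2) * (norm w)\<^sup>2"
    by (simp add: norm_mult power_mult_distrib algebra_simps)
  finally show ?thesis .
qed

text \<open>The arguments of \<open>y\<close> and \<open>1 + 1 / y\<close> have modulus at most \<open>pi / 2\<close>, so no multiple of \<open>2 * pi * \<i>\<close>
appears.\<close>

lemma Ln_add_1_right_half_plane:
  fixes y :: complex
  assumes "Re y \<ge> 0" "y \<noteq> 0"
  shows "Ln (y + 1) = Ln y + Ln (1 + 1 / y)"
proof -
  have re: "Re (1 + 1 / y) > 0"
    using assms by (simp add: add_pos_nonneg Re_divide)
  have "Ln (y * (1 + 1 / y)) = Ln y + Ln (1 + 1 / y)"
  proof (rule Ln_times_simple)
    show "1 + 1 / y \<noteq> 0" using re by (metis less_irrefl zero_complex.simps(1))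
    have "\<bar>Im (Ln y)\<bar> \<le> pi / 2" using assms Re_Ln_pos_le by blast
    moreover have "\<bar>Im (Ln (1 + 1 / y))\<bar> < pi / 2" using re by (rule Re_Ln_pos_lt_imp)
    ultimately show "- pi < Im (Ln y) + Im (Ln (1 + 1 / y))" "Im (Ln y) + Im (Ln (1 + 1 / y)) \<le> pi"
      by linarith+
  qed (use assms in auto)
  then show ?thesis using assms by (simp add: distrib_left)
qed

lemma Ln_add_of_nat_telescope:
  fixes y :: complex
  assumes "Re y \<ge> 0" "y \<noteq> 0"
  shows "Ln (y + of_nat N) = Ln y + (\<Sum>k<N. Ln (1 + 1 / (y + of_nat k)))"
proof (induction N)
  case (Suc N)
  have "y + of_nat N \<noteq> 0" using assms
    by (cases "N = 0") (auto simp: complex_eq_iff add_nonneg_eq_0_iff)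
  then have "Ln (y + of_nat N + 1) = Ln (y + of_nat N) + Ln (1 + 1 / (y + of_nat N))"
    using assms by (intro Ln_add_1_right_half_plane) auto
  then show ?case using Suc by (simp add: add_ac)
qed simp

text \<open>This is the classical asymptotic \<open>\<Gamma>(y + a) = \<Gamma>(y) y\<^sup>a (1 + O(1 / \<bar>y\<bar>))\<close>, uniformly in the closed right
half-plane. In Gauss's product the factor \<open>N\<^sup>a\<close> is asymptotic to \<open>(y + N + 1)\<^sup>a\<close>, which telescopes into
\<open>y\<^sup>a\<close> times factors \<open>(1 + w k)\<^sup>a\<close> with \<open>w k = 1 / (y + k)\<close>. Each of these is paired with the
factor \<open>1 / (1 + a * w k)\<close> of the Gamma quotient, and the logarithms of the pairs sum to
\<open>O(1 / \<bar>y\<bar>)\<close>. Stated with the entire function \<open>rGamma\<close>, it needs no separate argument that \<open>y + a\<close> is not a pole.\<close>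

lemma rGamma_shift_asymptotic:
  fixes a y :: complex
  assumes re: "Re y \<ge> 0" and y: "norm y \<ge> 4 + 4 * norm a"
  shows "\<exists>E. rGamma y = rGamma (y + a) * exp (a * Ln y + E) \<and>
             norm E \<le> 8 * (norm a + (norm a)\<^sup>2) / norm y"
proof -
  define w where "w = (\<lambda>k::nat. 1 / (y + of_nat k))"
  define L where "L = (\<lambda>k. a * Ln (1 + w k) - Ln (1 + a * w k))"
  define B where "B = 2 * (norm a + (norm a)\<^sup>2)"
  have B: "B \<ge> 0" by (simp add: B_def)
  have ny: "norm y \<ge> 1" using y norm_ge_zero[of a] by linarith
  have sq: "(norm y + real k)\<^sup>2 \<le> 2 * (norm (y + of_nat k))\<^sup>2" for k
    by (rule norm_add_of_nat_square_ge[OF re])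
  have nyk: "norm y \<le> norm (y + of_nat k)" for k
  proof -
    have "(norm y)\<^sup>2 \<le> (norm (y + of_nat k))\<^sup>2"
      using re by (simp add: cmod_power2 power2_sum)
    then show ?thesis by (rule power2_le_imp_le) simp
  qed
  have nz: "y + of_nat k \<noteq> 0" for k using nyk[of k] ny by auto
  have w: "norm (w k) \<le> 1 / 2" "norm (a * w k) \<le> 1 / 2" for k
  proof -
    have "norm (y + of_nat k) \<ge> 4 + 4 * norm a" using nyk[of k] y by linarith
    then have "2 \<le> norm (y + of_nat k)" "norm a * 2 \<le> norm (y + of_nat k)"
      using norm_ge_zero[of a] by linarith+
    then show "norm (w k) \<le> 1 / 2" "norm (a * w k) \<le> 1 / 2"
      by (auto simp: w_def norm_divide norm_mult divide_simps)
  qed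
  have L: "norm (L k) \<le> 2 * B * (1 / (norm y + real k)\<^sup>2)" for k
  proof -
    have "norm (L k) \<le> B * (norm (w k))\<^sup>2"
      unfolding L_def B_def by (rule norm_log_factor_le[OF w])
    also have "\<dots> \<le> B * (2 * (1 / (norm y + real k)\<^sup>2))"
    proof (rule mult_left_mono[OF _ B])
      have "norm (y + of_nat k) > 0" "norm y + real k > 0" using nz[of k] ny by auto
      then show "(norm (w k))\<^sup>2 \<le> 2 * (1 / (norm y + real k)\<^sup>2)" using sq[of k]
        by (simp add: w_def norm_divide power_divide divide_simps)
    qed
    finally show ?thesis by (simp add: mult_ac)
  qed
  have part: "(\<Sum>k<N. norm (L k)) \<le> 4 * B / norm y" for N
  proof -
    have "(\<Sum>k<N. norm (L k)) \<le> 2 * B * (\<Sum>k<N. 1 / (norm y + real k)\<^sup>2)"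
      unfolding sum_distrib_left by (intro sum_mono L)
    also have "\<dots> \<le> 2 * B * (2 / norm y)"
      using B by (intro mult_left_mono sum_inverse_square_shift_le ny) auto
    finally show ?thesis by simp
  qed
  have smn: "summable (\<lambda>k. norm (L k))" by (rule summableI_nonneg_bounded[OF _ part]) auto
  have sm: "summable L" by (rule summable_norm_cancel[OF smn])
  have "norm (suminf L) \<le> (\<Sum>k. norm (L k))" by (rule summable_norm[OF smn])
  also have "\<dots> \<le> 4 * B / norm y" by (rule suminf_le_const[OF smn part])
  finally have E: "norm (suminf L) \<le> 4 * B / norm y" .
  have series: "rGamma_series y N = rGamma_series (y + a) N *
      exp (a * (of_real (ln (real N)) - Ln (y + of_nat (Suc N))) + a * Ln y + (\<Sum>k<Suc N. L k))" for N
  proof -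
    have "y + of_nat k = (y + a + of_nat k) * exp (- Ln (1 + a * w k))" for k
    proof -
      have nz1: "1 + a * w k \<noteq> 0"
      proof
        assume "1 + a * w k = 0"
        then have "a * w k = - 1" by (simp add: add_eq_0_iff)
        then show False using w(2)[of k] by simp
      qed
      have "y + a + of_nat k = (y + of_nat k) * (1 + a * w k)"
        using nz[of k] by (simp add: w_def field_simps)
      then show ?thesis using nz1 by (simp add: exp_minus)
    qed
    then have "pochhammer y (Suc N) = (\<Prod>k<Suc N. (y + a + of_nat k) * exp (- Ln (1 + a * w k)))"
      unfolding pochhammer_prod atLeast0LessThan by (intro prod.cong) auto
    also have "\<dots> = pochhammer (y + a) (Suc N) * exp (\<Sum>k<Suc N. - Ln (1 + a * w k))"
      unfolding pochhammer_prod atLeast0LessThan by (simp only: prod.distrib exp_sum finite_lessThan)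
    finally have p: "pochhammer y (Suc N) = pochhammer (y + a) (Suc N) * exp (\<Sum>k<Suc N. - Ln (1 + a * w k))" .
    have "Ln (y + of_nat (Suc N)) = Ln y + (\<Sum>k<Suc N. Ln (1 + w k))"
      unfolding w_def using ny by (intro Ln_add_of_nat_telescope re) auto
    then have ex: "a * (of_real (ln (real N)) - Ln (y + of_nat (Suc N))) + a * Ln y + (\<Sum>k<Suc N. L k) =
        a * of_real (ln (real N)) + (\<Sum>k<Suc N. - Ln (1 + a * w k))"
      unfolding L_def sum_subtractf sum_negf sum_distrib_left[symmetric]
      by (simp add: algebra_simps del: sum.lessThan_Suc)
    show ?thesis unfolding ex
      by (simp add: rGamma_series_def p exp_add distrib_right del: sum.lessThan_Suc)
  qed
  have "(\<lambda>N. of_real (ln (real N)) - Ln (y + of_nat (Suc N))) \<longlonglongrightarrow> 0"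
  proof -
    have "(\<lambda>N. 1 + (y + 1) / of_nat N) \<longlonglongrightarrow> 1 + 0"
      by (intro tendsto_add tendsto_const lim_const_over_n)
    then have "(\<lambda>N. - Ln (1 + (y + 1) / of_nat N)) \<longlonglongrightarrow> - Ln (1 + 0)"
      by (intro tendsto_intros) auto
    then have "(\<lambda>N. - Ln (1 + (y + 1) / of_nat N)) \<longlonglongrightarrow> 0" by simp
    then show ?thesis
    proof (rule Lim_transform_eventually)
      show "\<forall>\<^sub>F N in sequentially. - Ln (1 + (y + 1) / of_nat N) =
          of_real (ln (real N)) - Ln (y + of_nat (Suc N))"
        using eventually_gt_at_top[of 0]
      proof eventually_elim
        case (elim N)
        have "Re (y + of_nat (Suc N)) > 0" using re by simp
        then have "y + of_nat (Suc N) \<noteq> 0" by (metis less_irrefl zero_complex.simps(1))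
        then have "Ln ((y + of_nat (Suc N)) / of_real (real N)) = Ln (y + of_nat (Suc N)) - of_real (ln (real N))"
          using elim by (subst Ln_divide_of_real) auto
        moreover have "(y + of_nat (Suc N)) / of_real (real N) = 1 + (y + 1) / of_nat N"
          using elim by (simp add: field_simps)
        ultimately show ?case by simp
      qed
    qed
  qed
  moreover have "(\<lambda>N. \<Sum>k<Suc N. L k) \<longlonglongrightarrow> suminf L"
    using LIMSEQ_Suc[OF summable_LIMSEQ[OF sm]] .
  ultimately have "(\<lambda>N. rGamma_series (y + a) N *
      exp (a * (of_real (ln (real N)) - Ln (y + of_nat (Suc N))) + a * Ln y + (\<Sum>k<Suc N. L k)))
      \<longlonglongrightarrow> rGamma (y + a) * exp (a * 0 + a * Ln y + suminf L)"
    by (intro tendsto_intros)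
  then have "(\<lambda>N. rGamma_series y N) \<longlonglongrightarrow> rGamma (y + a) * exp (a * Ln y + suminf L)"
    by (simp only: series mult_zero_right add_0_left)
  then have "rGamma y = rGamma (y + a) * exp (a * Ln y + suminf L)"
    using LIMSEQ_unique rGamma_series_LIMSEQ by blast
  then show ?thesis using E by (intro exI[of _ "suminf L"]) (simp add: B_def)
qed

text \<open>With \<open>y = \<i> * \<omega> * n\<close>, the quotient of consecutive coefficients is \<open>y powr (\<i> * \<omega>)\<close> up to a factor
\<open>1 + O(1 / n)\<close>. Since \<open>y\<close> lies on the imaginary axis, its argument is exactly \<open>\<plusminus> pi / 2\<close>; it
contributes the modulus \<open>exp (- \<bar>v\<bar>)\<close>, and the modulus of \<open>y\<close> contributes the logarithmic phase.\<close>

lemma Gamma_vertical_step_asymptotic: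
  fixes u :: complex and v :: real
  assumes v: "v \<noteq> 0"
  defines "\<omega> \<equiv> 2 * v / pi"
  shows "\<exists>C N E. C \<ge> 0 \<and> (\<forall>n\<ge>N. norm (E n) \<le> C / real n \<and>
           Gamma (u + \<i> * of_real \<omega> * of_nat (Suc n)) =
           Gamma (u + \<i> * of_real \<omega> * of_nat n) *
             exp (\<i> * of_real (\<omega> * ln (\<bar>\<omega>\<bar> * real n)) + E n) / of_real (exp \<bar>v\<bar>))"
proof -
  have l: "\<omega> \<noteq> 0" using v by (simp add: \<omega>_def)
  define Y where "Y = (\<lambda>n::nat. \<i> * of_real \<omega> * of_nat n)"
  define s where "s = \<i> * complex_of_real \<omega>"
  define D where "D = (\<lambda>a::complex. 8 * (norm a + (norm a)\<^sup>2))"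
  have nY: "norm (Y n) = \<bar>\<omega>\<bar> * real n" for n by (simp add: Y_def norm_mult)
  obtain N where N: "real N \<ge> (4 + 4 * norm u + 4 * norm (u + s)) / \<bar>\<omega>\<bar>"
    using real_arch_simple by blast
  have "\<exists>E. norm E \<le> ((D u + D (u + s)) / \<bar>\<omega>\<bar>) / real n \<and>
      Gamma (u + \<i> * of_real \<omega> * of_nat (Suc n)) = Gamma (u + \<i> * of_real \<omega> * of_nat n) *
             exp (\<i> * of_real (\<omega> * ln (\<bar>\<omega>\<bar> * real n)) + E) / of_real (exp \<bar>v\<bar>)" if n: "n \<ge> N" for n
  proof -
    have "\<bar>\<omega>\<bar> * real n \<ge> \<bar>\<omega>\<bar> * real N" using n by (intro mult_left_mono) auto
    moreover have "\<bar>\<omega>\<bar> * real N \<ge> 4 + 4 * norm u + 4 * norm (u + s)" using N l by (simp add: field_simps)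
    ultimately have ge: "norm (Y n) \<ge> 4 + 4 * norm u" "norm (Y n) \<ge> 4 + 4 * norm (u + s)"
      unfolding nY using norm_ge_zero[of u] norm_ge_zero[of "u + s"] by linarith+
    have re: "Re (Y n) \<ge> 0" by (simp add: Y_def)
    have "norm (Y n) > 0" using ge(1) norm_ge_zero[of u] by linarith
    then have n0: "n > 0" by (simp add: nY zero_less_mult_iff)
    from rGamma_shift_asymptotic[OF re ge(1)] obtain E1 where
      E1: "rGamma (Y n) = rGamma (Y n + u) * exp (u * Ln (Y n) + E1)" "norm E1 \<le> D u / norm (Y n)"
      unfolding D_def by blast
    from rGamma_shift_asymptotic[OF re ge(2)] obtain E2 where
      E2: "rGamma (Y n) = rGamma (Y n + (u + s)) * exp ((u + s) * Ln (Y n) + E2)"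
        "norm E2 \<le> D (u + s) / norm (Y n)"
      unfolding D_def by blast
    have "rGamma (Y n + u) = rGamma (Y n + u) * exp (u * Ln (Y n) + E1) * exp (- (u * Ln (Y n) + E1))"
      by (simp only: mult.assoc exp_minus_inverse mult_1_right)
    also have "\<dots> = rGamma (Y n + (u + s)) * exp ((u + s) * Ln (Y n) + E2) * exp (- (u * Ln (Y n) + E1))"
      by (simp only: E1(1)[symmetric] E2(1)[symmetric])
    also have "\<dots> = rGamma (Y n + (u + s)) * exp (s * Ln (Y n) + (E2 - E1))"
      by (simp only: mult.assoc exp_add[symmetric]) (simp add: algebra_simps)
    finally have "Gamma (Y n + (u + s)) = Gamma (Y n + u) * exp (s * Ln (Y n) + (E2 - E1))"
      by (simp add: Gamma_def)
    moreover have "s * Ln (Y n) = \<i> * of_real (\<omega> * ln (\<bar>\<omega>\<bar> * real n)) - of_real \<bar>v\<bar>"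
    proof -
      have "Y n = of_real (\<bar>\<omega>\<bar> * real n) * (of_real (sgn \<omega>) * \<i>)"
      proof -
        have "\<bar>\<omega>\<bar> * sgn \<omega> = \<omega>" by (rule abs_mult_sgn)
        then have "complex_of_real \<omega> = of_real \<bar>\<omega>\<bar> * of_real (sgn \<omega>)" by (metis of_real_mult)
        then show ?thesis unfolding Y_def by (simp only: of_real_mult of_real_of_nat_eq mult_ac)
      qed
      moreover have "\<bar>\<omega>\<bar> * real n > 0" "of_real (sgn \<omega>) * \<i> \<noteq> 0"
        using l n0 by (auto simp: sgn_zero_iff)
      ultimately have "Ln (Y n) = of_real (ln (\<bar>\<omega>\<bar> * real n)) + Ln (of_real (sgn \<omega>) * \<i>)"
        by (metis Ln_times_of_real Ln_of_real)
      also have "Ln (of_real (sgn \<omega>) * \<i>) = of_real (sgn \<omega>) * \<i> * of_real (pi / 2)"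
        using l by (simp add: sgn_real_def)
      finally have "s * Ln (Y n) = \<i> * of_real (\<omega> * ln (\<bar>\<omega>\<bar> * real n)) +
          (\<i> * \<i>) * of_real ((\<omega> * sgn \<omega>) * (pi / 2))"
        by (simp add: s_def algebra_simps)
      moreover have "(\<omega> * sgn \<omega>) * (pi / 2) = \<bar>v\<bar>"
        by (simp add: \<omega>_def abs_sgn[symmetric] abs_mult flip: mult.assoc)
      ultimately have "s * Ln (Y n) = \<i> * of_real (\<omega> * ln (\<bar>\<omega>\<bar> * real n)) + (\<i> * \<i>) * of_real \<bar>v\<bar>"
        by (simp only:)
      then show ?thesis by simp
    qed
    ultimately have "Gamma (Y n + (u + s)) = Gamma (Y n + u) *
        exp ((\<i> * of_real (\<omega> * ln (\<bar>\<omega>\<bar> * real n)) + (E2 - E1)) - of_real \<bar>v\<bar>)"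
      by (simp only: algebra_simps)
    then have "Gamma (Y n + (u + s)) = Gamma (Y n + u) *
        exp (\<i> * of_real (\<omega> * ln (\<bar>\<omega>\<bar> * real n)) + (E2 - E1)) / of_real (exp \<bar>v\<bar>)"
      by (subst (asm) exp_diff) (simp add: exp_of_real del: of_real_mult)
    moreover have "norm (E2 - E1) \<le> ((D u + D (u + s)) / \<bar>\<omega>\<bar>) / real n"
    proof -
      have "norm (E2 - E1) \<le> D (u + s) / norm (Y n) + D u / norm (Y n)"
        using norm_triangle_ineq4[of E2 E1] E1(2) E2(2) by linarith
      then show ?thesis unfolding nY by (simp add: add_divide_distrib[symmetric] add.commute)
    qed
    moreover have "Y n + u = u + \<i> * of_real \<omega> * of_nat n"
      "Y n + (u + s) = u + \<i> * of_real \<omega> * of_nat (Suc n)"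
      by (simp_all add: Y_def s_def algebra_simps)
    ultimately show ?thesis by metis
  qed
  then obtain E where "\<forall>n\<ge>N. norm (E n) \<le> ((D u + D (u + s)) / \<bar>\<omega>\<bar>) / real n \<and>
      Gamma (u + \<i> * of_real \<omega> * of_nat (Suc n)) = Gamma (u + \<i> * of_real \<omega> * of_nat n) *
             exp (\<i> * of_real (\<omega> * ln (\<bar>\<omega>\<bar> * real n)) + E n) / of_real (exp \<bar>v\<bar>)"
    by metis
  moreover have "(D u + D (u + s)) / \<bar>\<omega>\<bar> \<ge> 0" by (simp add: D_def)
  ultimately show ?thesis by blast
qed

section \<open>Series with logarithmic phase\<close>

text \<open>An eventual estimate of the coefficient quotients becomes one from the first index on, of the
shape that telescopes to binomial coefficients.\<close>

lemma exp_bound_imp_linear_bound: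
  fixes x :: "nat \<Rightarrow> real"
  assumes x: "\<And>n. n \<ge> N \<Longrightarrow> x n \<le> exp (C / real n)" and C: "C \<ge> 0"
  shows "\<exists>K::nat. \<forall>n. x n \<le> 1 + real K / (real n + 1)"
proof -
  define B where "B = 2 * C * exp C + (\<Sum>n<Suc N. (real n + 1) * \<bar>x n\<bar>)"
  obtain K where K: "real K \<ge> B" using real_arch_simple by blast
  have "(real n + 1) * (x n - 1) \<le> B" for n
  proof (cases "n < Suc N")
    case True
    have "(real n + 1) * (x n - 1) \<le> (real n + 1) * \<bar>x n\<bar>" by (intro mult_left_mono) auto
    also have "\<dots> \<le> (\<Sum>n<Suc N. (real n + 1) * \<bar>x n\<bar>)"
      using True by (intro member_le_sum) auto
    also have "\<dots> \<le> B" using C by (simp add: B_def)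
    finally show ?thesis .
  next
    case False
    then have n: "n \<ge> N" "real n \<ge> 1" by auto
    define t where "t = C / real n"
    have t: "0 \<le> t" "t \<le> C" using n C mult_left_mono[of 1 "real n" C] by (auto simp: t_def divide_simps)
    have "1 + (- t) \<le> exp (- t)" by (rule exp_ge_add_one_self)
    then have "(1 + (- t)) * exp t \<le> exp (- t) * exp t" by (intro mult_right_mono) auto
    then have "exp t - 1 \<le> t * exp t" by (simp add: algebra_simps flip: exp_add)
    also have "\<dots> \<le> t * exp C" using t by (intro mult_left_mono) auto
    finally have "x n - 1 \<le> t * exp C" using x[OF n(1)] by (simp add: t_def)
    then have "(real n + 1) * (x n - 1) \<le> (2 * real n) * (t * exp C)"
      using n t by (intro order_trans[OF mult_left_mono mult_right_mono]) auto
    also have "\<dots> = 2 * C * exp C" using n by (simp add: t_def)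
    also have "\<dots> \<le> B" by (simp add: B_def sum_nonneg)
    finally show ?thesis .
  qed
  then have "x n \<le> 1 + real K / (real n + 1)" for n
    using K order_trans[of "(real n + 1) * (x n - 1)" B "real K"] by (simp add: field_simps)
  then show ?thesis by blast
qed

text \<open>The phase \<open>\<omega> * ln (\<kappa> * n)\<close> is unbounded while its increments tend to zero, so it comes close to every
angle modulo \<open>2 * pi\<close> and then stays close for arbitrarily many steps. The indices are obtained by
solving \<open>\<omega> * ln (\<kappa> * x) + \<alpha> = \<plusminus> 2 * pi * j\<close> for real \<open>x\<close> and rounding down.\<close>

lemma exists_indices_log_phase:
  fixes \<omega> \<kappa> \<alpha> :: real
  assumes "\<omega> \<noteq> 0" "\<kappa> > 0"
  shows "\<exists>m. filterlim m at_top sequentially \<and>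
    (\<forall>l. (\<lambda>j. exp (\<i> * of_real (\<omega> * ln (\<kappa> * real (m j + l)) + \<alpha>))) \<longlonglongrightarrow> 1)"
proof -
  define T where "T = (\<lambda>j. (2 * pi * real j - sgn \<omega> * \<alpha>) / \<bar>\<omega>\<bar>)"
  define X where "X = (\<lambda>j. exp (T j) / \<kappa>)"
  define m where "m = (\<lambda>j. nat \<lfloor>X j\<rfloor>)"
  have X0: "X j > 0" for j using assms by (simp add: X_def)
  have "filterlim T at_top sequentially"
  proof -
    have "filterlim (\<lambda>j. - (sgn \<omega> * \<alpha> / \<bar>\<omega>\<bar>) + 2 * pi / \<bar>\<omega>\<bar> * real j) at_top sequentially"
      using assms by (intro filterlim_tendsto_add_at_top[OF tendsto_const]
        filterlim_tendsto_pos_mult_at_top[OF tendsto_const _ filterlim_real_sequentially]) auto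
    then show ?thesis by (simp add: T_def diff_divide_distrib)
  qed
  then have Xtop: "filterlim X at_top sequentially"
    unfolding X_def divide_inverse using assms
    by (subst mult.commute, intro filterlim_tendsto_pos_mult_at_top[OF tendsto_const]
          filterlim_compose[OF exp_at_top]) auto
  have mX: "X j - 1 \<le> real (m j)" "real (m j) \<le> X j" for j
    using X0[of j] by (auto simp: m_def)
  have mtop: "filterlim m at_top sequentially"
  proof -
    have "filterlim (\<lambda>j. - 1 + X j) at_top sequentially"
      by (rule filterlim_tendsto_add_at_top[OF tendsto_const Xtop])
    then have "filterlim (\<lambda>j. real (m j)) at_top sequentially"
      by (rule filterlim_at_top_mono) (use mX in auto)
    then show ?thesis by (simp add: filterlim_sequentially_iff_filterlim_real)
  qed
  have "(\<lambda>j. exp (\<i> * of_real (\<omega> * ln (\<kappa> * real (m j + l)) + \<alpha>))) \<longlonglongrightarrow> 1" for l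
  proof -
    have inv: "(\<lambda>j. 1 / X j) \<longlonglongrightarrow> 0"
      using tendsto_inverse_0_at_top[OF Xtop] by (simp add: inverse_eq_divide)
    have "(\<lambda>j. real (m j + l) / X j) \<longlonglongrightarrow> 1"
    proof (rule tendsto_sandwich)
      show "(\<lambda>j. 1 - 1 / X j) \<longlonglongrightarrow> 1" using tendsto_diff[OF tendsto_const inv, of 1] by simp
      show "(\<lambda>j. 1 + real l * (1 / X j)) \<longlonglongrightarrow> 1"
        using tendsto_add[OF tendsto_const tendsto_mult[OF tendsto_const inv], of 1 "real l"] by simp
      show "\<forall>\<^sub>F j in sequentially. 1 - 1 / X j \<le> real (m j + l) / X j"
      proof (intro always_eventually allI)
        fix j
        have "1 - 1 / X j = (X j - 1) / X j" using X0[of j] by (simp add: diff_divide_distrib)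
        also have "\<dots> \<le> real (m j + l) / X j"
          using mX(1)[of j] X0[of j] by (intro divide_right_mono) auto
        finally show "1 - 1 / X j \<le> real (m j + l) / X j" .
      qed
      show "\<forall>\<^sub>F j in sequentially. real (m j + l) / X j \<le> 1 + real l * (1 / X j)"
      proof (intro always_eventually allI)
        fix j
        have "real (m j + l) / X j \<le> (X j + real l) / X j"
          using mX(2)[of j] X0[of j] by (intro divide_right_mono) auto
        also have "\<dots> = 1 + real l * (1 / X j)" using X0[of j] by (simp add: add_divide_distrib)
        finally show "real (m j + l) / X j \<le> 1 + real l * (1 / X j)" .
      qed
    qed
    then have "(\<lambda>j. ln (real (m j + l) / X j)) \<longlonglongrightarrow> ln 1" by (intro tendsto_intros) auto
    then have "(\<lambda>j. exp (\<i> * of_real (\<omega> * ln (real (m j + l) / X j)))) \<longlonglongrightarrow> exp (\<i> * of_real (\<omega> * ln 1))"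
      by (intro tendsto_exp tendsto_mult tendsto_const tendsto_of_real)
    then have "(\<lambda>j. exp (\<i> * of_real (\<omega> * ln (real (m j + l) / X j)))) \<longlonglongrightarrow> 1" by simp
    then show ?thesis
    proof (rule Lim_transform_eventually)
      have "\<forall>\<^sub>F j in sequentially. m j > 0"
        using eventually_gt_at_top[of "0::nat"] mtop by (rule eventually_compose_filterlim)
      then show "\<forall>\<^sub>F j in sequentially. exp (\<i> * of_real (\<omega> * ln (real (m j + l) / X j))) =
          exp (\<i> * of_real (\<omega> * ln (\<kappa> * real (m j + l)) + \<alpha>))"
      proof eventually_elim
        case (elim j)
        have "ln (real (m j + l) / X j) = ln (\<kappa> * real (m j + l)) - T j"
          using elim X0[of j] assms by (simp add: X_def ln_div ln_mult)
        then have L: "ln (\<kappa> * real (m j + l)) = ln (real (m j + l) / X j) + T j" by simp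
        have "\<omega> * T j = sgn \<omega> * (2 * pi * real j) - \<alpha>"
          using assms by (auto simp: T_def sgn_real_def field_simps)
        then have "\<omega> * ln (\<kappa> * real (m j + l)) + \<alpha> =
            \<omega> * ln (real (m j + l) / X j) + 2 * pi * (sgn \<omega> * real j)"
          unfolding L distrib_left by simp
        moreover have "exp (\<i> * of_real (2 * pi * (sgn \<omega> * real j))) = 1"
          using assms unfolding exp_eq_1
          by (auto simp: sgn_real_def intro: exI[of _ "int j"] exI[of _ "- int j"])
        ultimately show ?case by (simp only: of_real_add distrib_left exp_add) simp
      qed
    qed
  qed
  then show ?thesis using mtop by blast
qed

text \<open>Rotating and scaling moves an arbitrary boundary point \<open>z0\<close> to \<open>1\<close>; this only adds the constant
\<open>\<alpha> = Arg z0\<close> to the phase of the coefficient quotients, and the logarithmic phase takes every value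
modulo \<open>2 * pi\<close> in the limit, so no boundary point is regular.\<close>

lemma natural_boundary_of_log_phase:
  fixes a :: "nat \<Rightarrow> complex" and \<omega> \<kappa> R :: real
  assumes nz: "\<And>n. a n \<noteq> 0" and R: "R > 0" and \<omega>: "\<omega> \<noteq> 0" and \<kappa>: "\<kappa> > 0" and C: "C \<ge> 0"
    and E: "\<And>n. n \<ge> N \<Longrightarrow> norm (E n) \<le> C / real n"
    and a: "\<And>n. n \<ge> N \<Longrightarrow> a (Suc n) = a n * exp (\<i> * of_real (\<omega> * ln (\<kappa> * real n)) + E n) / of_real R"
  shows "has_natural_boundary a R"
proof -
  have E0: "E \<longlonglongrightarrow> 0"
  proof (rule Lim_null_comparison)
    show "\<forall>\<^sub>F n in sequentially. norm (E n) \<le> C / real n"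
      using E eventually_ge_at_top by (rule eventually_mono[rotated]) 
    show "(\<lambda>n. C / real n) \<longlonglongrightarrow> 0" by (rule lim_const_over_n)
  qed
  have na: "norm (a (Suc n)) = norm (a n) * exp (Re (E n)) / R" if "n \<ge> N" for n
    unfolding a[OF that] using R by (simp add: norm_mult norm_divide)
  have "conv_radius a = ereal R"
  proof (rule conv_radius_ratio_limit_nonzero[OF refl])
    have "(\<lambda>n. R / exp (Re (E n))) \<longlonglongrightarrow> R / exp (Re 0)"
      by (intro tendsto_intros E0) auto
    then have "(\<lambda>n. R / exp (Re (E n))) \<longlonglongrightarrow> R" by simp
    then show "(\<lambda>n. norm (a n) / norm (a (Suc n))) \<longlonglongrightarrow> R"
    proof (rule Lim_transform_eventually)
      show "\<forall>\<^sub>F n in sequentially. R / exp (Re (E n)) = norm (a n) / norm (a (Suc n))"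
        using eventually_ge_at_top[of N] by eventually_elim (use nz R in \<open>simp add: na\<close>)
    qed
  qed (use R in auto)
  moreover have False if z0: "norm z0 = R" and r: "r > 0" and hol: "g holomorphic_on ball z0 r"
    and g: "\<And>z. z \<in> ball z0 r \<inter> ball 0 R \<Longrightarrow> g z = (\<Sum>n. a n * z ^ n)" for z0 r g
  proof -
    have z0_nz: "z0 \<noteq> 0" using z0 R by auto
    define b where "b = (\<lambda>n. a n * z0 ^ n)"
    have bnz: "b n \<noteq> 0" for n using nz z0_nz by (simp add: b_def)
    define \<alpha> where "\<alpha> = Arg z0"
    have z0_eq: "z0 = of_real R * exp (\<i> * of_real \<alpha>)"
      using Arg_eq[OF z0_nz] z0 by (simp add: \<alpha>_def)
    \<comment> \<open>The modulus \<open>R\<close> of \<open>z0\<close> cancels the factor \<open>1 / R\<close> of the quotients.\<close>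
    have b_step: "b (Suc n) = b n * exp (\<i> * of_real (\<omega> * ln (\<kappa> * real n) + \<alpha>) + E n)"
      if "n \<ge> N" for n
    proof -
      have "b (Suc n) = b n * exp (\<i> * of_real (\<omega> * ln (\<kappa> * real n)) + E n) * (z0 / of_real R)"
        using a[OF that] by (simp add: b_def)
      also have "z0 / of_real R = exp (\<i> * of_real \<alpha>)" using R by (subst z0_eq) simp
      finally show ?thesis by (simp add: exp_add[symmetric] algebra_simps)
    qed
    have nb: "norm (b (Suc n)) = norm (b n) * exp (Re (E n))" if "n \<ge> N" for n
      unfolding b_step[OF that] by (simp add: norm_mult)
    have ReE: "\<bar>Re (E n)\<bar> \<le> C / real n" if "n \<ge> N" for n
      using E[OF that] abs_Re_le_cmod order_trans by blast
    define x where "x = (\<lambda>n. max (norm (b (Suc n)) / norm (b n)) (norm (b n) / norm (b (Suc n))))"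
    have "\<exists>K::nat. \<forall>n. x n \<le> 1 + real K / (real n + 1)"
    proof (rule exp_bound_imp_linear_bound[OF _ C])
      show "x n \<le> exp (C / real n)" if "n \<ge> N" for n
      proof -
        have "norm (b (Suc n)) / norm (b n) = exp (Re (E n))"
          "norm (b n) / norm (b (Suc n)) = exp (- Re (E n))"
          using nb[OF that] bnz[of n] by (simp_all add: exp_minus divide_inverse)
        then show ?thesis using ReE[OF that] by (simp add: x_def abs_le_iff)
      qed
    qed
    then obtain K :: nat where K: "\<And>n. x n \<le> 1 + real K / (real n + 1)" by blast
    have up: "norm (b (Suc n)) \<le> (1 + real K / (real n + 1)) * norm (b n)" for n
      using K[of n] bnz[of n] by (simp add: x_def pos_divide_le_eq)
    have lo: "norm (b n) \<le> (1 + real K / (real n + 1)) * norm (b (Suc n))" for n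
      using K[of n] bnz[of "Suc n"] by (simp add: x_def pos_divide_le_eq)
    from exists_indices_log_phase[OF \<omega> \<kappa>, of \<alpha>] obtain m where
      m: "filterlim m at_top sequentially"
        "\<And>l. (\<lambda>j. exp (\<i> * of_real (\<omega> * ln (\<kappa> * real (m j + l)) + \<alpha>))) \<longlonglongrightarrow> 1" by blast
    have ml: "filterlim (\<lambda>j. m j + l) at_top sequentially" for l
      by (rule filterlim_at_top_mono[OF m(1)]) auto
    have lim: "(\<lambda>j. b (m j + l) / b (m j)) \<longlonglongrightarrow> 1" for l
    proof (induction l)
      case (Suc l)
      have "(\<lambda>j. b (m j + l) / b (m j) *
          (exp (\<i> * of_real (\<omega> * ln (\<kappa> * real (m j + l)) + \<alpha>)) * exp (E (m j + l)))) \<longlonglongrightarrow> 1 * (1 * exp 0)"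
        by (intro tendsto_mult Suc m(2) tendsto_exp filterlim_compose[OF E0 ml])
      then have "(\<lambda>j. b (m j + l) / b (m j) *
          (exp (\<i> * of_real (\<omega> * ln (\<kappa> * real (m j + l)) + \<alpha>)) * exp (E (m j + l)))) \<longlonglongrightarrow> 1"
        by simp
      then show ?case
      proof (rule Lim_transform_eventually)
        have "\<forall>\<^sub>F j in sequentially. m j + l \<ge> N"
          using ml[of l] unfolding filterlim_at_top by blast
        then show "\<forall>\<^sub>F j in sequentially. b (m j + l) / b (m j) *
          (exp (\<i> * of_real (\<omega> * ln (\<kappa> * real (m j + l)) + \<alpha>)) * exp (E (m j + l))) =
          b (m j + Suc l) / b (m j)"
        proof eventually_elim
          case (elim j)
          show ?case using b_step[OF elim] by (simp add: exp_add del: of_real_add of_nat_add)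
        qed
      qed
    qed (use bnz in simp)
    show False
    proof (rule singular_at_1_of_ratio_limit[of b K m "r / R" "\<lambda>\<zeta>. g (z0 * \<zeta>)", OF bnz up lo lim])
      show "r / R > 0" using r R by simp
      have map: "z0 * \<zeta> \<in> ball z0 r" if "\<zeta> \<in> ball 1 (r / R)" for \<zeta>
      proof -
        have "norm (z0 - z0 * \<zeta>) = R * norm (1 - \<zeta>)"
          unfolding z0[symmetric] norm_mult[symmetric] by (simp add: algebra_simps)
        then show ?thesis using that R by (simp add: dist_norm field_simps)
      qed
      have "(g \<circ> (\<lambda>\<zeta>. z0 * \<zeta>)) holomorphic_on ball 1 (r / R)"
        using map by (intro holomorphic_on_compose_gen[OF _ hol] holomorphic_intros) auto
      then show "(\<lambda>\<zeta>. g (z0 * \<zeta>)) holomorphic_on ball 1 (r / R)" by (simp add: o_def)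
      show "g (z0 * \<zeta>) = (\<Sum>n. b n * \<zeta> ^ n)" if "\<zeta> \<in> ball 1 (r / R) \<inter> ball 0 1" for \<zeta>
      proof -
        have "z0 * \<zeta> \<in> ball z0 r \<inter> ball 0 R" using that map z0 R by (auto simp: norm_mult)
        from g[OF this] show ?thesis by (simp add: b_def power_mult_distrib mult.assoc)
      qed
    qed
  qed
  ultimately show ?thesis unfolding has_natural_boundary_def by blast
qed

section \<open>The natural boundary of the Gamma series\<close>

theorem mainTheorem3:
  fixes u :: complex and v :: real
  assumes "v \<noteq> 0"
    and "- u \<notin> {of_nat m + 2 * \<i> * of_real v / of_real pi * of_nat n | m n :: nat. True}"
  shows "has_natural_boundary
           (\<lambda>n. Gamma (u + 2 * \<i> * of_real v * of_nat n / of_real pi)) (exp \<bar>v\<bar>)"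
proof -
  define \<omega> where "\<omega> = 2 * v / pi"
  have arg: "u + 2 * \<i> * of_real v * of_nat n / of_real pi = u + \<i> * of_real \<omega> * of_nat n" for n
    by (simp add: \<omega>_def field_simps)
  obtain C N E where C: "C \<ge> 0"
    and step: "\<And>n. n \<ge> N \<Longrightarrow> norm (E n) \<le> C / real n \<and>
           Gamma (u + \<i> * of_real \<omega> * of_nat (Suc n)) =
           Gamma (u + \<i> * of_real \<omega> * of_nat n) *
             exp (\<i> * of_real (\<omega> * ln (\<bar>\<omega>\<bar> * real n)) + E n) / of_real (exp \<bar>v\<bar>)"
    using Gamma_vertical_step_asymptotic[OF assms(1), of u] unfolding \<omega>_def by blast
  have nz: "Gamma (u + \<i> * of_real \<omega> * of_nat n) \<noteq> 0" for n
  proof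
    assume "Gamma (u + \<i> * of_real \<omega> * of_nat n) = 0"
    then have "u + \<i> * of_real \<omega> * of_nat n \<in> \<int>\<^sub>\<le>\<^sub>0" by (simp add: Gamma_eq_zero_iff)
    then obtain k where "u + \<i> * of_real \<omega> * of_nat n = - of_nat k" by (elim nonpos_Ints_cases')
    then have "- u = of_nat k + \<i> * of_real \<omega> * of_nat n"
      by (metis add.commute add.inverse_inverse minus_add_distrib add_minus_cancel)
    then have "- u = of_nat k + 2 * \<i> * of_real v / of_real pi * of_nat n"
      by (simp add: \<omega>_def mult_ac)
    then show False using assms(2) by blast
  qed
  have "has_natural_boundary (\<lambda>n. Gamma (u + \<i> * of_real \<omega> * of_nat n)) (exp \<bar>v\<bar>)"
    using assms(1) C step nz
    by (intro natural_boundary_of_log_phase[where \<omega> = \<omega> and \<kappa> = "\<bar>\<omega>\<bar>" and E = E and N = N and C = C])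
      (auto simp: \<omega>_def)
  then show ?thesis by (simp only: arg)
qed

end
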